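(* If $R$ is a fusion ring, then $R$ is faithfully graded by $\mathrm{Gal}(\mathbb{K}_1/\mathbb{K}_0)$.
   Context: A fusion ring is a unital ring $R$, free as a $\mathbb{Z}$-module, with a distinguished finite basis $1=b_0,\ldots,b_n$ such that (a) $b_ib_j=\sum_{k=0}^n c_{ij}^k b_k$ with $c_{ij}^k\in\mathbb{Z}_{\geq0}$, and (b) there is an anti-involution $b_i\mapsto b_i^\ast$ of the basis (extended linearly to $R$) such that $c_{ij}^0=1$ if $b_i=b_j^\ast$ and $c_{ij}^0=0$ otherwise. $\mathrm{FPdim}(b_i)$ is the Frobenius-Perron eigenvalue (spectral radius) of the matrix $(c_{ij}^k)_{j,k}$, extended $\mathbb{Z}$-linearly to a ring homomorphism $\mathrm{FPdim}:R\to\mathbb{C}$, and $\mathrm{FPdim}(R):=\sum_{j=0}^n\mathrm{FPdim}(b_j)^2$. Set $\mathbb{K}_0:=\mathbb{Q}(\mathrm{FPdim}(R))$ and $\mathbb{K}_1:=\mathbb{Q}(\mathrm{FPdim}(x):x\in R)$. A grading of $R$ by a finite group $G$ is a partition $B=\bigcup_{g\in G}B_g$ of the basis $B$ such that if $b_i\in B_g$ and $b_j\in B_h$, then $b_ib_j$ is a $\mathbb{Z}_{\geq0}$-linear combination of elements of $B_{gh}$; it is faithful if every $B_g$ is nonempty. *)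

theory Defs
  imports
    "HOL-Algebra.Algebra"
    "HOL-Algebra.Algebraic_Closure_Type"
    "Jordan_Normal_Form.Spectral_Radius"
begin

section \<open>Fusion rings\<close>

text \<open>A distinguished basis is given as an indexed family \<open>b 0, \<dots>, b n\<close>. Coordinate functions are
  extensional outside \<open>{..n}\<close> so that they can be unique; uniqueness forces \<open>b\<close> to be injective on
  \<open>{..n}\<close>.\<close>

definition is_int_basis :: "('a, 'm) ring_scheme \<Rightarrow> nat \<Rightarrow> (nat \<Rightarrow> 'a) \<Rightarrow> bool" where
  "is_int_basis R n b \<longleftrightarrow>
     b \<in> {..n} \<rightarrow> carrier R \<and>
     (\<forall>x\<in>carrier R. \<exists>!a. a \<in> {..n} \<rightarrow>\<^sub>E (UNIV :: int set) \<and>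
        x = (\<Oplus>\<^bsub>R\<^esub>k\<in>{..n}. add_pow R (a k) (b k)))"

definition basis_coord :: "('a, 'm) ring_scheme \<Rightarrow> nat \<Rightarrow> (nat \<Rightarrow> 'a) \<Rightarrow> 'a \<Rightarrow> nat \<Rightarrow> int" where
  "basis_coord R n b x =
     (THE a. a \<in> {..n} \<rightarrow>\<^sub>E (UNIV :: int set) \<and> x = (\<Oplus>\<^bsub>R\<^esub>k\<in>{..n}. add_pow R (a k) (b k)))"

text \<open>\<open>str_const R n b i j k\<close> is the structure constant $c_{ij}^k$.\<close>

definition str_const ::
    "('a, 'm) ring_scheme \<Rightarrow> nat \<Rightarrow> (nat \<Rightarrow> 'a) \<Rightarrow> nat \<Rightarrow> nat \<Rightarrow> nat \<Rightarrow> int" where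
  "str_const R n b i j k = basis_coord R n b (b i \<otimes>\<^bsub>R\<^esub> b j) k"

definition anti_involution :: "('a, 'm) ring_scheme \<Rightarrow> ('a \<Rightarrow> 'a) \<Rightarrow> bool" where
  "anti_involution R s \<longleftrightarrow>
     s \<in> carrier R \<rightarrow> carrier R \<and>
     (\<forall>x\<in>carrier R. s (s x) = x) \<and>
     (\<forall>x\<in>carrier R. \<forall>y\<in>carrier R. s (x \<oplus>\<^bsub>R\<^esub> y) = s x \<oplus>\<^bsub>R\<^esub> s y) \<and>
     (\<forall>x\<in>carrier R. \<forall>y\<in>carrier R. s (x \<otimes>\<^bsub>R\<^esub> y) = s y \<otimes>\<^bsub>R\<^esub> s x)"

locale fusion_ring = ring R for R (structure) +
  fixes n :: nat and b :: "nat \<Rightarrow> 'a"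
  assumes basis: "is_int_basis R n b"
    and basis_one: "b 0 = \<one>"
    and str_const_nonneg: "\<lbrakk>i \<le> n; j \<le> n; k \<le> n\<rbrakk> \<Longrightarrow> 0 \<le> str_const R n b i j k"
    and duality: "\<exists>s. anti_involution R s \<and> s ` b ` {..n} \<subseteq> b ` {..n} \<and>
      (\<forall>i\<le>n. \<forall>j\<le>n. str_const R n b i j 0 = (if b i = s (b j) then 1 else 0))"


section \<open>Frobenius--Perron dimensions\<close>

definition FPdim_basis :: "('a, 'm) ring_scheme \<Rightarrow> nat \<Rightarrow> (nat \<Rightarrow> 'a) \<Rightarrow> nat \<Rightarrow> complex" where
  "FPdim_basis R n b i = complex_of_real
     (spectral_radius (mat (Suc n) (Suc n) (\<lambda>(j, k). of_int (str_const R n b i j k))))"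

definition FPdim :: "('a, 'm) ring_scheme \<Rightarrow> nat \<Rightarrow> (nat \<Rightarrow> 'a) \<Rightarrow> 'a \<Rightarrow> complex" where
  "FPdim R n b x = (\<Sum>k\<le>n. of_int (basis_coord R n b x k) * FPdim_basis R n b k)"

definition FPdim_ring :: "('a, 'm) ring_scheme \<Rightarrow> nat \<Rightarrow> (nat \<Rightarrow> 'a) \<Rightarrow> complex" where
  "FPdim_ring R n b = (\<Sum>j\<le>n. (FPdim R n b (b j))\<^sup>2)"


section \<open>The fields and the Galois group\<close>

abbreviation complex_field :: "complex ring" where
  "complex_field \<equiv> ring_of_type_algebra"

text \<open>A subfield of the complex numbers contains the rationals, so the subfield generated by a set
  \<open>S\<close> is the extension of the rationals generated by \<open>S\<close>.\<close>

definition K0 :: "('a, 'm) ring_scheme \<Rightarrow> nat \<Rightarrow> (nat \<Rightarrow> 'a) \<Rightarrow> complex set" where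
  "K0 R n b = generate_field complex_field {FPdim_ring R n b}"

definition K1 :: "('a, 'm) ring_scheme \<Rightarrow> nat \<Rightarrow> (nat \<Rightarrow> 'a) \<Rightarrow> complex set" where
  "K1 R n b = generate_field complex_field (FPdim R n b ` carrier R)"

text \<open>The group, under composition, of field automorphisms of \<open>L\<close> that fix \<open>K\<close> pointwise. As for
  \<^const>\<open>BijGroup\<close>, automorphisms are taken extensional outside \<open>L\<close>.\<close>

definition Gal :: "complex set \<Rightarrow> complex set \<Rightarrow> (complex \<Rightarrow> complex) monoid" where
  "Gal L K = BijGroup L \<lparr>carrier :=
     {\<sigma> \<in> Bij L. \<sigma> \<in> ring_iso (complex_field\<lparr>carrier := L\<rparr>) (complex_field\<lparr>carrier := L\<rparr>) \<and>
        (\<forall>x\<in>K. \<sigma> x = x)}\<rparr>"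


section \<open>Gradings\<close>

definition fusion_grading ::
    "('a, 'm) ring_scheme \<Rightarrow> nat \<Rightarrow> (nat \<Rightarrow> 'a) \<Rightarrow> ('g, 'l) monoid_scheme \<Rightarrow> ('g \<Rightarrow> 'a set) \<Rightarrow> bool"
  where
  "fusion_grading R n b G B \<longleftrightarrow>
     group G \<and> finite (carrier G) \<and>
     (\<Union>g\<in>carrier G. B g) = b ` {..n} \<and>
     disjoint_family_on B (carrier G) \<and>
     (\<forall>g\<in>carrier G. \<forall>h\<in>carrier G. \<forall>x\<in>B g. \<forall>y\<in>B h.
        \<exists>a :: 'a \<Rightarrow> nat. x \<otimes>\<^bsub>R\<^esub> y = (\<Oplus>\<^bsub>R\<^esub>z\<in>B (g \<otimes>\<^bsub>G\<^esub> h). add_pow R (a z) z))"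

definition faithful_fusion_grading ::
    "('a, 'm) ring_scheme \<Rightarrow> nat \<Rightarrow> (nat \<Rightarrow> 'a) \<Rightarrow> ('g, 'l) monoid_scheme \<Rightarrow> ('g \<Rightarrow> 'a set) \<Rightarrow> bool"
  where
  "faithful_fusion_grading R n b G B \<longleftrightarrow>
     fusion_grading R n b G B \<and> (\<forall>g\<in>carrier G. B g \<noteq> {})"

end

theory Submission
  imports Defs "HOL-Analysis.Function_Topology"
begin

text \<open>Right multiplication by the sum of the basis is a strictly positive matrix. Left
  multiplications commute with it, so they act on its Perron line by a positive character \<open>d\<close>, and
  \<open>d i = FPdim (b i)\<close> since an eigenvalue with a positive eigenvector is the spectral radius.

  For \<open>\<sigma>\<close> in the Galois group, \<open>i \<mapsto> \<sigma> (d i)\<close> is again a character, so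
  \<open>\<bar>\<sigma> (d i)\<bar> \<le> d i\<close>. As \<open>\<sigma>\<close> fixes \<open>\<Sum>i. (d i)\<^sup>2\<close>, equality is forced in
  \<open>Re (\<sigma> (d i)\<^sup>2) \<le> (d i)\<^sup>2\<close>, that is \<open>\<sigma> (d i) = \<plusminus> d i\<close>. The sets
  \<open>{i. \<sigma> (d i) = - d i}\<close> embed the group into subsets under symmetric difference, and the signs
  are multiplicative in \<open>i\<close> along nonzero structure constants. Thus \<open>i\<close> is graded by the dual group;
  choosing pivot indices \<open>J\<close>, on which the group becomes all of \<open>Pow J\<close>, identifies the group with
  its dual, and the pivots themselves have the singletons as degrees, so every degree occurs.\<close>

subsection \<open>Perron--Frobenius theory\<close>

text \<open>The eigenvalue is the largest \<open>t\<close> such that \<open>t * v \<le> A v\<close> for a probability vector \<open>v\<close>;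
  were the inequality strict somewhere, applying \<open>A\<close> once more would allow a larger \<open>t\<close>.\<close>

lemma perron_eigenvector:
  fixes A :: "nat \<Rightarrow> nat \<Rightarrow> real"
  assumes pos: "\<And>i j. \<lbrakk>i \<le> n; j \<le> n\<rbrakk> \<Longrightarrow> 0 < A i j"
  obtains v t where "\<And>i. i \<le> n \<Longrightarrow> 0 < v i"
    and "\<And>i. i \<le> n \<Longrightarrow> (\<Sum>j\<le>n. A i j * v j) = t * v i"
proof -
  \<comment> \<open>Coordinates above \<open>n\<close> are pinned to \<open>0\<close>, so
    \<open>Q\<close> is a product of compact sets and Tychonoff applies.\<close>
  define Q :: "(nat \<Rightarrow> real) set" where "Q = PiE UNIV (\<lambda>i. if i \<le> n then {0..1} else {0})"
  \<comment> \<open>Summing the inequalities in \<open>F\<close> over \<open>i\<close>, with weights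
    of total \<open>1\<close> and none above \<open>1\<close>, bounds every admissible eigenvalue by
    \<open>K\<close>.\<close>
  define K where "K = (\<Sum>i\<le>n. \<Sum>j\<le>n. A i j)"
  define F where "F = {p :: (nat \<Rightarrow> real) \<times> real. (\<Sum>i\<le>n. fst p i) = 1 \<and>
      (\<forall>i\<le>n. snd p * fst p i \<le> (\<Sum>j\<le>n. A i j * fst p j))}"
  have "compact Q"
    unfolding Q_def compactin_euclidean_iff[symmetric] euclidean_product_topology[symmetric]
    by (subst compactin_PiE) auto
  moreover have cont: "continuous_on UNIV (\<lambda>p :: (nat \<Rightarrow> real) \<times> real. fst p i)" for i
    by (rule continuous_on_product_then_coordinatewise[OF continuous_on_fst[OF continuous_on_id]])
  have "closed F"
    unfolding F_def
    by (intro closed_Collect_conj closed_Collect_all closed_Collect_imp closed_Collect_le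
        closed_Collect_eq continuous_intros cont) auto
  ultimately have "compact ((Q \<times> {0..K}) \<inter> F)"
    by (intro compact_Int_closed compact_Times) auto
  moreover have "((\<lambda>i. if i = 0 then 1 else 0), 0) \<in> (Q \<times> {0..K}) \<inter> F"
    using pos by (auto simp: Q_def F_def K_def less_imp_le intro!: sum_nonneg)
  ultimately obtain p where p: "p \<in> (Q \<times> {0..K}) \<inter> F"
    and max: "\<And>q. q \<in> (Q \<times> {0..K}) \<inter> F \<Longrightarrow> snd q \<le> snd p"
    using continuous_attains_sup[of "(Q \<times> {0..K}) \<inter> F" snd] continuous_on_snd[OF continuous_on_id]
    by blast
  obtain v t where vt: "p = (v, t)" by (cases p)
  have v0: "0 \<le> v i" if "i \<le> n" for i
    using p that by (auto simp: vt Q_def PiE_iff split: if_splits)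
  have v1: "(\<Sum>i\<le>n. v i) = 1" and le: "\<And>i. i \<le> n \<Longrightarrow> t * v i \<le> (\<Sum>j\<le>n. A i j * v j)"
    and t0: "0 \<le> t"
    using p by (auto simp: vt F_def)
  \<comment> \<open>A strictly positive matrix makes nonzero nonnegative vectors strictly positive;
    this is used for \<open>v\<close> and for the defect \<open>w - t * v\<close>.\<close>
  have spos: "0 < (\<Sum>j\<le>n. A i j * u j)"
    if "i \<le> n" "\<And>j. j \<le> n \<Longrightarrow> 0 \<le> u j" "k \<le> n" "u k \<noteq> 0" for i u k
    by (rule sum_pos2[of _ k])
       (use that pos in \<open>auto simp: less_imp_le order_less_le\<close>)
  obtain k where k: "k \<le> n" "v k \<noteq> 0"
    using v1 by (metis atMost_iff sum.neutral zero_neq_one)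
  define w where "w i = (\<Sum>j\<le>n. A i j * v j)" for i
  have wpos: "0 < w i" if "i \<le> n" for i
    unfolding w_def by (rule spos[of i v, OF that v0 k])
  have "w i = t * v i" if i: "i \<le> n" for i
  proof (rule ccontr)
    assume ne: "w i \<noteq> t * v i"
    define z where "z i = (\<Sum>j\<le>n. A i j * (w j - t * v j))" for i
    have zpos: "0 < z j" if "j \<le> n" for j
      unfolding z_def by (rule spos[of _ _ i]) (use that le ne i in \<open>auto simp: w_def\<close>)
    have z: "z j = (\<Sum>l\<le>n. A j l * w l) - t * w j" for j
      by (simp add: z_def w_def algebra_simps sum_subtractf sum_distrib_left)
    \<comment> \<open>The smallest relative gain: since \<open>z = A w - t * w\<close> is positive
      everywhere, \<open>t + e\<close> is feasible for \<open>w\<close> scaled to total mass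
      \<open>1\<close>.\<close>
    define e where "e = Min ((\<lambda>j. z j / w j) ` {..n})"
    have epos: "0 < e" unfolding e_def by (subst Min_gr_iff) (auto intro!: divide_pos_pos zpos wpos)
    have ele: "e * w j \<le> z j" if "j \<le> n" for j
    proof -
      have "e \<le> z j / w j" unfolding e_def using that by (intro Min_le) auto
      then show ?thesis using wpos[OF that] by (simp add: field_simps)
    qed
    define W where "W = (\<Sum>j\<le>n. w j)"
    have Wpos: "0 < W" unfolding W_def using wpos by (intro sum_pos) auto
    define q where "q j = (if j \<le> n then w j / W else 0)" for j
    have q1: "(\<Sum>j\<le>n. q j) = 1"
      using Wpos by (simp add: q_def W_def flip: sum_divide_distrib)
    have q0: "0 \<le> q j" for j using wpos Wpos by (auto simp: q_def less_imp_le)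
    have qle1: "q j \<le> 1" for j
    proof (cases "j \<le> n")
      case True
      then have "q j \<le> (\<Sum>j\<le>n. q j)" by (intro member_le_sum) (auto intro: q0)
      then show ?thesis using q1 by simp
    qed (simp add: q_def)
    have qF: "(t + e) * q j \<le> (\<Sum>l\<le>n. A j l * q l)" if "j \<le> n" for j
    proof -
      have "(t + e) * w j \<le> (\<Sum>l\<le>n. A j l * w l)"
        using ele[OF that] z[of j] by (simp add: algebra_simps)
      then have "(t + e) * w j / W \<le> (\<Sum>l\<le>n. A j l * w l) / W"
        using Wpos by (simp add: divide_right_mono)
      then show ?thesis using that by (simp add: q_def sum_divide_distrib)
    qed
    have "t + e = (\<Sum>j\<le>n. (t + e) * q j)" by (simp add: q1 flip: sum_distrib_left)
    also have "\<dots> \<le> (\<Sum>j\<le>n. \<Sum>l\<le>n. A j l * q l)" by (intro sum_mono qF) auto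
    also have "\<dots> \<le> K" unfolding K_def
      by (intro sum_mono) (use pos qle1 in \<open>auto simp: mult_left_le less_imp_le\<close>)
    finally have "(q, t + e) \<in> (Q \<times> {0..K}) \<inter> F"
      using t0 epos q1 qF q0 qle1 by (auto simp: Q_def F_def) (auto simp: q_def)
    from max[OF this] epos show False by (simp add: vt)
  qed
  with wpos t0 have "0 < v i" if "i \<le> n" for i
    using that v0[OF that] by (metis mult_zero_right order_less_le)
  with \<open>\<And>i. i \<le> n \<Longrightarrow> w i = t * v i\<close> show ?thesis
    by (intro that) (auto simp: w_def)
qed

text \<open>With \<open>s\<close> the largest ratio \<open>u i / v i\<close>, the vector
  \<open>s * v - u\<close> is nonnegative, satisfies the same eigenvalue equation and vanishes at a
  maximising index \<open>k\<close>. Row \<open>k\<close> of \<open>A\<close> is strictly positive,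
  so the vector vanishes altogether.\<close>

lemma perron_eigenvector_unique:
  fixes A :: "nat \<Rightarrow> nat \<Rightarrow> real"
  assumes pos: "\<And>i j. \<lbrakk>i \<le> n; j \<le> n\<rbrakk> \<Longrightarrow> 0 < A i j"
    and v: "\<And>i. i \<le> n \<Longrightarrow> 0 < v i" "\<And>i. i \<le> n \<Longrightarrow> (\<Sum>j\<le>n. A i j * v j) = t * v i"
    and u: "\<And>i. i \<le> n \<Longrightarrow> (\<Sum>j\<le>n. A i j * u j) = t * u i"
  obtains s where "\<And>i. i \<le> n \<Longrightarrow> u i = s * v i"
proof -
  define s where "s = Max ((\<lambda>i. u i / v i) ` {..n})"
  have "s \<in> (\<lambda>i. u i / v i) ` {..n}" unfolding s_def by (intro Max_in) auto
  then obtain k where k: "k \<le> n" "s = u k / v k" by auto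
  have nonneg: "0 \<le> s * v i - u i" if "i \<le> n" for i
  proof -
    have "u i / v i \<le> s" unfolding s_def using that by (intro Max_ge) auto
    then show ?thesis using v(1)[OF that] by (simp add: field_simps)
  qed
  have "(\<Sum>j\<le>n. A k j * (s * v j - u j)) = s * (\<Sum>j\<le>n. A k j * v j) - (\<Sum>j\<le>n. A k j * u j)"
    by (simp add: algebra_simps sum_subtractf sum_distrib_left)
  also have "\<dots> = t * (s * v k - u k)" using v(2) u k by (simp add: algebra_simps)
  also have "\<dots> = 0" using k v(1)[of k] by simp
  finally have "\<forall>j\<in>{..n}. A k j * (s * v j - u j) = 0"
    by (subst (asm) sum_nonneg_eq_0_iff) (use nonneg pos k in \<open>auto simp: less_imp_le\<close>)
  then have "u i = s * v i" if "i \<le> n" for i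
    using that pos[OF k(1), of i] by force
  then show ?thesis by (rule that)
qed

text \<open>Compare \<open>w\<close> with \<open>v\<close> in the maximum norm weighted by \<open>v\<close>.\<close>

lemma eigenvalue_norm_le_positive_eigenvalue:
  fixes A :: "nat \<Rightarrow> nat \<Rightarrow> real" and w :: "nat \<Rightarrow> complex"
  assumes A: "\<And>i j. \<lbrakk>i \<le> n; j \<le> n\<rbrakk> \<Longrightarrow> 0 \<le> A i j"
    and v: "\<And>i. i \<le> n \<Longrightarrow> 0 < v i" "\<And>i. i \<le> n \<Longrightarrow> (\<Sum>j\<le>n. A i j * v j) = t * v i"
    and w: "\<And>i. i \<le> n \<Longrightarrow> (\<Sum>j\<le>n. A i j * w j) = l * w i"
    and m: "m \<le> n" "w m \<noteq> 0"
  shows "norm l \<le> t"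
proof -
  define s where "s = Max ((\<lambda>i. norm (w i) / v i) ` {..n})"
  have "s \<in> (\<lambda>i. norm (w i) / v i) ` {..n}" unfolding s_def by (intro Max_in) auto
  then obtain k where k: "k \<le> n" "s = norm (w k) / v k" by auto
  have le: "norm (w i) \<le> s * v i" if "i \<le> n" for i
  proof -
    have "norm (w i) / v i \<le> s" unfolding s_def using that by (intro Max_ge) auto
    then show ?thesis using v(1)[OF that] by (simp add: field_simps)
  qed
  have "0 < norm (w m)" using m by simp
  also have "\<dots> \<le> s * v m" using le m by simp
  finally have s: "0 < s" using v(1)[OF m(1)] by (simp add: zero_less_mult_iff)
  have "norm l * (s * v k) = norm (l * w k)"
    using k v(1)[of k] by (simp add: norm_mult)
  also have "\<dots> = norm (\<Sum>j\<le>n. A k j * w j)" using w k(1) by simp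
  also have "\<dots> \<le> (\<Sum>j\<le>n. norm (A k j * w j))" by (rule norm_sum)
  also have "\<dots> \<le> (\<Sum>j\<le>n. A k j * (s * v j))"
    by (intro sum_mono) (simp add: norm_mult mult_left_mono A k(1) le)
  also have "\<dots> = s * (\<Sum>j\<le>n. A k j * v j)" by (simp add: sum_distrib_left algebra_simps)
  also have "\<dots> = t * (s * v k)" using v(2)[OF k(1)] by simp
  finally show ?thesis using s v(1)[OF k(1)] by simp
qed

text \<open>The positive eigenvector puts \<open>t\<close> into the spectrum, and the weighted norm
  bound keeps all eigenvalues within norm \<open>t\<close>.\<close>

lemma spectral_radius_positive_eigenvector:
  fixes A :: "nat \<Rightarrow> nat \<Rightarrow> real"
  assumes A: "\<And>i j. \<lbrakk>i \<le> n; j \<le> n\<rbrakk> \<Longrightarrow> 0 \<le> A i j"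
    and v: "\<And>i. i \<le> n \<Longrightarrow> 0 < v i" "\<And>i. i \<le> n \<Longrightarrow> (\<Sum>j\<le>n. A i j * v j) = t * v i"
  shows "spectral_radius (mat (Suc n) (Suc n) (\<lambda>(i, j). complex_of_real (A i j))) = t"
    (is "spectral_radius ?M = t")
proof -
  have t0: "0 \<le> t"
  proof -
    have "0 \<le> (\<Sum>j\<le>n. A 0 j * v j)" using A v(1) by (intro sum_nonneg) (auto simp: less_imp_le)
    then show ?thesis using v[of 0] by (simp add: zero_le_mult_iff)
  qed
  have M: "?M \<in> carrier_mat (Suc n) (Suc n)" by simp
  have idx: "(?M *\<^sub>v w) $ i = (\<Sum>j\<le>n. A i j * w $ j)" if "w \<in> carrier_vec (Suc n)" "i \<le> n" for w i
    using that by (simp add: scalar_prod_def atLeast0LessThan lessThan_Suc_atMost)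
  have ev: "eigenvalue ?M (of_real t)"
    unfolding eigenvalue_def eigenvector_def
  proof (intro exI conjI)
    let ?w = "vec (Suc n) (\<lambda>i. complex_of_real (v i))"
    show "?w \<in> carrier_vec (dim_row ?M)" by simp
    show "?w \<noteq> 0\<^sub>v (dim_row ?M)"
      using v(1)[of 0] by (auto simp: vec_eq_iff)
    show "?M *\<^sub>v ?w = of_real t \<cdot>\<^sub>v ?w"
    proof (rule eq_vecI)
      fix i assume "i < dim_vec (complex_of_real t \<cdot>\<^sub>v ?w)"
      then have i: "i \<le> n" by simp
      have "(?M *\<^sub>v ?w) $ i = (\<Sum>j\<le>n. A i j * ?w $ j)" using i by (intro idx) auto
      also have "\<dots> = of_real (\<Sum>j\<le>n. A i j * v j)" by simp
      finally show "(?M *\<^sub>v ?w) $ i = (of_real t \<cdot>\<^sub>v ?w) $ i"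
        using v(2)[OF i] i by simp
    qed simp
  qed
  have bound: "norm l \<le> t" if l: "eigenvalue ?M l" for l
  proof -
    obtain w where w: "w \<in> carrier_vec (Suc n)" "w \<noteq> 0\<^sub>v (Suc n)" "?M *\<^sub>v w = l \<cdot>\<^sub>v w"
      using l unfolding eigenvalue_def eigenvector_def by auto
    have "\<exists>m\<le>n. w $ m \<noteq> 0"
    proof (rule ccontr)
      assume "\<not> (\<exists>m\<le>n. w $ m \<noteq> 0)"
      then have "w = 0\<^sub>v (Suc n)" using w(1) by (intro eq_vecI) auto
      with w(2) show False by simp
    qed
    then obtain m where "m \<le> n" "w $ m \<noteq> 0" by auto
    moreover have "(\<Sum>j\<le>n. A i j * w $ j) = l * w $ i" if "i \<le> n" for i
      using idx[OF w(1) that] w that by simp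
    ultimately show ?thesis by (intro eigenvalue_norm_le_positive_eigenvalue[OF A v]) auto
  qed
  show ?thesis
    unfolding spectral_radius_def
  proof (rule Max_eqI)
    show "finite (norm ` spectrum ?M)" using card_finite_spectrum(1)[OF M] by simp
    show "t \<in> norm ` spectrum ?M"
      using ev t0 by (auto simp: spectrum_def intro!: image_eqI[of _ _ "complex_of_real t"])
  qed (use bound in \<open>auto simp: spectrum_def\<close>)
qed

subsection \<open>Families closed under symmetric difference\<close>

text \<open>Parity of the intersection with \<open>U\<close> is a linear functional over the field
  with two elements: the points of \<open>A \<inter> B \<inter> U\<close> are counted twice and
  cancel.\<close>

lemma even_card_sym_diff_Int:
  assumes "finite U"
  shows "even (card (sym_diff A B \<inter> U)) \<longleftrightarrow> (even (card (A \<inter> U)) \<longleftrightarrow> even (card (B \<inter> U)))"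
proof -
  have A: "card (A \<inter> U) = card ((A - B) \<inter> U) + card (A \<inter> B \<inter> U)"
    using assms by (subst card_Un_disjoint[symmetric]) (auto intro!: arg_cong[where f = card])
  have B: "card (B \<inter> U) = card ((B - A) \<inter> U) + card (A \<inter> B \<inter> U)"
    using assms by (subst card_Un_disjoint[symmetric]) (auto intro!: arg_cong[where f = card])
  have "card (sym_diff A B \<inter> U) = card ((A - B) \<inter> U) + card ((B - A) \<inter> U)"
    using assms by (subst card_Un_disjoint[symmetric]) (auto intro!: arg_cong[where f = card])
  then show ?thesis using A B by auto
qed

text \<open>Linear algebra over the field with two elements: a proper subspace lies in the kernel of
  a nonzero functional, encoded by \<open>U\<close>. The induction splits off one coordinate
  \<open>x\<close> and passes to the members \<open>H'\<close> avoiding it.\<close>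

lemma proper_sym_diff_closed_annihilator:
  assumes "finite S" "H \<subset> Pow S" "{} \<in> H"
    and "\<And>A B. \<lbrakk>A \<in> H; B \<in> H\<rbrakk> \<Longrightarrow> sym_diff A B \<in> H"
  shows "\<exists>U\<subseteq>S. U \<noteq> {} \<and> (\<forall>T\<in>H. even (card (T \<inter> U)))"
  using assms
proof (induction S arbitrary: H rule: finite_induct)
  case empty
  then show ?case by auto
next
  case (insert x S)
  define H' where "H' = {T \<in> H. x \<notin> T}"
  have H'_sub: "H' \<subseteq> Pow S" using insert.prems(1) by (auto simp: H'_def)
  show ?case
  proof (cases "H' = Pow S")
    case True
    \<comment> \<open>A member \<open>T0\<close> containing \<open>x\<close> would, together with
      all of \<open>Pow S\<close>, generate every subset, contrary to properness. Hence
      \<open>{x}\<close> annihilates \<open>H\<close>.\<close>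
    have "x \<notin> T0" if "T0 \<in> H" for T0
    proof
      assume x: "x \<in> T0"
      have "T \<in> H" if T: "T \<subseteq> insert x S" for T
      proof (cases "x \<in> T")
        case False
        then show ?thesis using T True by (auto simp: H'_def)
      next
        case xT: True
        have "sym_diff T T0 \<in> Pow S" using x xT T that insert.prems(1) \<open>T0 \<in> H\<close> by auto
        then have "sym_diff (sym_diff T T0) T0 \<in> H"
          using True \<open>T0 \<in> H\<close> insert.prems(3) unfolding H'_def by blast
        moreover have "sym_diff (sym_diff T T0) T0 = T" by auto
        ultimately show ?thesis by simp
      qed
      then show False using insert.prems(1) by auto
    qed
    then show ?thesis by (intro exI[of _ "{x}"]) auto
  next
    case False
    have "\<exists>U\<subseteq>S. U \<noteq> {} \<and> (\<forall>T\<in>H'. even (card (T \<inter> U)))"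
      by (rule insert.IH) (use False H'_sub insert.prems in \<open>auto simp: H'_def\<close>)
    then obtain U where U: "U \<subseteq> S" "U \<noteq> {}" "\<And>T. T \<in> H' \<Longrightarrow> even (card (T \<inter> U))"
      by blast
    have fin: "finite U" using U(1) insert.hyps(1) finite_subset by blast
    have "x \<notin> U" using U(1) insert.hyps(2) by auto
    consider "\<And>T. \<lbrakk>T \<in> H; x \<in> T\<rbrakk> \<Longrightarrow> even (card (T \<inter> U))"
      | T0 where "T0 \<in> H" "x \<in> T0" "odd (card (T0 \<inter> U))" by blast
    then show ?thesis
    proof cases
      case 1
      then have "even (card (T \<inter> U))" if "T \<in> H" for T using U(3)[of T] that by (auto simp: H'_def)
      then show ?thesis using U by blast
    next
      case 2
      \<comment> \<open>Members containing \<open>x\<close> differ from \<open>T0\<close> by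
        elements of \<open>H'\<close>, so all of them meet \<open>U\<close> in an odd number of
        points; adding \<open>x\<close> to \<open>U\<close> corrects exactly these.\<close>
      have "even (card (T \<inter> insert x U))" if T: "T \<in> H" for T
      proof (cases "x \<in> T")
        case True
        then have "sym_diff T T0 \<in> H'" using T 2 insert.prems(3) by (auto simp: H'_def)
        from U(3)[OF this] 2 have "odd (card (T \<inter> U))"
          by (simp add: even_card_sym_diff_Int[OF fin])
        then show ?thesis using True fin \<open>x \<notin> U\<close> by simp
      next
        case False
        then show ?thesis using U(3)[of T] T by (simp add: H'_def)
      qed
      then show ?thesis using U(1) by (intro exI[of _ "insert x U"]) auto
    qed
  qed
qed

text \<open>Take \<open>J\<close> minimal such that \<open>A \<mapsto> A \<inter> J\<close> is injective. If it were not onto, a parity relation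
  would recover some \<open>u \<in> J\<close> from the other coordinates.\<close>

lemma sym_diff_closed_pivots:
  assumes "finite N" "F \<subseteq> Pow N" "F \<noteq> {}"
    and closed: "\<And>A B. \<lbrakk>A \<in> F; B \<in> F\<rbrakk> \<Longrightarrow> sym_diff A B \<in> F"
  obtains J where "J \<subseteq> N" "bij_betw (\<lambda>A. A \<inter> J) F (Pow J)"
proof -
  let ?P = "\<lambda>J. J \<subseteq> N \<and> inj_on (\<lambda>A. A \<inter> J) F"
  have "?P N" using assms(2) by (auto simp: inj_on_def Int_absorb2 subset_iff)
  then obtain J where J: "?P J" and min: "\<And>J'. ?P J' \<Longrightarrow> card J \<le> card J'"
    using ex_has_least_nat[of ?P N card] by blast
  have finJ: "finite J" using J assms(1) finite_subset by blast
  obtain A0 where "A0 \<in> F" using assms(3) by auto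
  from closed[OF this this] have empty: "{} \<in> F" by simp
  have "(\<lambda>A. A \<inter> J) ` F = Pow J"
  proof (rule ccontr)
    assume ne: "(\<lambda>A. A \<inter> J) ` F \<noteq> Pow J"
    have cl: "sym_diff A B \<in> (\<lambda>A. A \<inter> J) ` F" if AB: "A \<in> (\<lambda>A. A \<inter> J) ` F" "B \<in> (\<lambda>A. A \<inter> J) ` F" for A B
    proof -
      obtain A' B' where "A' \<in> F" "B' \<in> F" "A = A' \<inter> J" "B = B' \<inter> J" using AB by auto
      then show ?thesis using closed by (intro image_eqI[of _ _ "sym_diff A' B'"]) auto
    qed
    obtain U where U: "U \<subseteq> J" "U \<noteq> {}" "\<forall>T\<in>(\<lambda>A. A \<inter> J) ` F. even (card (T \<inter> U))"
      using proper_sym_diff_closed_annihilator[OF finJ _ _ cl] ne empty by blast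
    then obtain u where u: "u \<in> U" by auto
    have "inj_on (\<lambda>A. A \<inter> (J - {u})) F"
    proof (rule inj_onI)
      fix A B assume AB: "A \<in> F" "B \<in> F" "A \<inter> (J - {u}) = B \<inter> (J - {u})"
      \<comment> \<open>Members agreeing on \<open>J - {u}\<close> can differ on \<open>J\<close>
        only in \<open>u\<close>, and evenness on \<open>U\<close> excludes that. So
        \<open>J - {u}\<close> would still separate \<open>F\<close>, against minimality.\<close>
      define D where "D = sym_diff A B"
      have D: "D \<inter> J \<subseteq> {u}" using AB(3) by (auto simp: D_def)
      have "even (card (D \<inter> J \<inter> U))" using U(3) closed AB by (auto simp: D_def)
      moreover have "D \<inter> J \<inter> U = {u}" if "u \<in> D" using D U(1) u that by auto
      ultimately have "u \<notin> D" by auto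
      then have "A \<inter> J = B \<inter> J" using D by (auto simp: D_def)
      then show "A = B" using J AB(1,2) by (auto dest: inj_onD)
    qed
    then have "card J \<le> card (J - {u})" using J by (intro min) auto
    then show False using u U(1) finJ by (metis card_Diff1_less leD subsetD)
  qed
  then show ?thesis using J by (intro that[of J]) (auto simp: bij_betw_def)
qed

text \<open>\<open>M i j k\<close> stands for \<open>k\<close> occurring in the product of \<open>i\<close> and \<open>j\<close>.\<close>

lemma (in group) onto_grading_of_sign_patterns:
  fixes E :: "'a \<Rightarrow> 'i set"
  assumes N: "finite N" "N \<noteq> {}"
    and E: "\<And>g. g \<in> carrier G \<Longrightarrow> E g \<subseteq> N" "inj_on E (carrier G)"
      "\<And>g h. \<lbrakk>g \<in> carrier G; h \<in> carrier G\<rbrakk> \<Longrightarrow> E (g \<otimes> h) = sym_diff (E g) (E h)"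
    and M: "\<And>g i j k. \<lbrakk>g \<in> carrier G; i \<in> N; j \<in> N; k \<in> N; M i j k\<rbrakk> \<Longrightarrow> k \<in> E g \<longleftrightarrow> (i \<in> E g) \<noteq> (j \<in> E g)"
    and M_ex: "\<And>i j. \<lbrakk>i \<in> N; j \<in> N\<rbrakk> \<Longrightarrow> \<exists>k\<in>N. M i j k"
  obtains \<gamma> where "\<gamma> ` N = carrier G"
    and "\<And>i j k. \<lbrakk>i \<in> N; j \<in> N; k \<in> N; M i j k\<rbrakk> \<Longrightarrow> \<gamma> k = \<gamma> i \<otimes> \<gamma> j"
proof -
  have closed: "sym_diff A B \<in> E ` carrier G" if AB: "A \<in> E ` carrier G" "B \<in> E ` carrier G" for A B
  proof -
    obtain g h where "g \<in> carrier G" "h \<in> carrier G" "A = E g" "B = E h" using AB by auto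
    then show ?thesis by (auto simp: E(3) intro!: image_eqI[of _ _ "g \<otimes> h"])
  qed
  obtain J where J: "J \<subseteq> N" "bij_betw (\<lambda>A. A \<inter> J) (E ` carrier G) (Pow J)"
    using sym_diff_closed_pivots[OF N(1) _ _ closed] E(1) carrier_not_empty by blast
  \<comment> \<open>\<open>f\<close> gives the coordinates of a group element on the pivots; the
    elements \<open>f' {j}\<close> with \<open>j\<close> in \<open>J\<close> form the corresponding
    basis over the field with two elements.\<close>
  define f where "f g = E g \<inter> J" for g
  have f: "bij_betw f (carrier G) (Pow J)"
    using bij_betw_trans[OF inj_on_imp_bij_betw[OF E(2)] J(2)] by (simp add: f_def[abs_def] comp_def)
  define f' where "f' = inv_into (carrier G) f"
  have f': "f' A \<in> carrier G" "f (f' A) = A" if "A \<subseteq> J" for A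
    using that f bij_betw_inv_into_right[OF f] bij_betw_imp_surj_on[OF f]
    by (auto simp: f'_def intro!: inv_into_into)
  have f_mult: "f (g \<otimes> h) = sym_diff (f g) (f h)" if "g \<in> carrier G" "h \<in> carrier G" for g h
    using E(3)[OF that] by (auto simp: f_def)
  \<comment> \<open>For fixed \<open>i\<close> in \<open>N\<close>, membership of \<open>i\<close>
    in \<open>E g\<close> is a homomorphism in \<open>g\<close> to the group of order two;
    \<open>T i\<close> lists its values on the basis \<open>f' {j}\<close>.\<close>
  define T where "T i = {j \<in> J. i \<in> E (f' {j})}" for i
  have T_sub: "T i \<subseteq> J" for i by (auto simp: T_def)
  have T_mult: "T k = sym_diff (T i) (T j)" if "i \<in> N" "j \<in> N" "k \<in> N" "M i j k" for i j k
    using M[OF f'(1) that] by (auto simp: T_def)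
  \<comment> \<open>\<open>E (f' {l})\<close> meets \<open>J\<close> only in \<open>l\<close>, so
    the pivots give the dual basis.\<close>
  have T_pivot: "T j = {j}" if "j \<in> J" for j
  proof -
    have "j \<in> E (f' {l}) \<longleftrightarrow> j = l" if "l \<in> J" for l
      using f'(2)[of "{l}"] that \<open>j \<in> J\<close> by (auto simp: f_def)
    then show ?thesis using that by (auto simp: T_def)
  qed
  have T_surj: "\<exists>i\<in>N. T i = A" if "A \<subseteq> J" for A
    using finite_subset[OF subset_trans[OF that J(1)] N(1)] that
  \<comment> \<open>A constituent of \<open>i\<close> times itself has degree \<open>{}\<close>; a
    constituent of an index of degree \<open>A\<close> times the pivot \<open>j\<close> has degree
    \<open>insert j A\<close>.\<close>
  proof (induction A rule: finite_induct)
    case empty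
    obtain i where i: "i \<in> N" using N(2) by auto
    then obtain k where "k \<in> N" "M i i k" using M_ex by blast
    then show ?case using T_mult[of i i k] i by auto
  next
    case (insert j A)
    then obtain i where i: "i \<in> N" "T i = A" by auto
    have j: "j \<in> N" using insert.prems J(1) by auto
    with i obtain k where k: "k \<in> N" "M i j k" using M_ex by blast
    then have "T k = insert j A"
      using T_mult[OF i(1) j k] T_pivot[of j] insert.prems insert.hyps(2) i(2) by auto
    then show ?case using k(1) by auto
  qed
  \<comment> \<open>The pivot coordinates serve both the group and its dual, which turns degrees
    into group elements.\<close>
  define \<gamma> where "\<gamma> i = f' (T i)" for i
  have \<gamma>: "\<gamma> i \<in> carrier G" "f (\<gamma> i) = T i" for i
    unfolding \<gamma>_def using f' T_sub by auto
  show ?thesis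
  proof (rule that[of \<gamma>])
    have "g \<in> \<gamma> ` N" if g: "g \<in> carrier G" for g
    proof -
      have "f g \<subseteq> J" by (auto simp: f_def)
      from T_surj[OF this] obtain i where "i \<in> N" "f g = T i" by auto
      then have "\<gamma> i = g"
        using g \<gamma>[of i] by (intro inj_onD[OF bij_betw_imp_inj_on[OF f]]) auto
      with \<open>i \<in> N\<close> show ?thesis by auto
    qed
    with \<gamma>(1) show "\<gamma> ` N = carrier G" by auto
  next
    fix i j k assume "i \<in> N" "j \<in> N" "k \<in> N" "M i j k"
    then have "f (\<gamma> k) = f (\<gamma> i \<otimes> \<gamma> j)" using T_mult \<gamma> by (simp add: f_mult)
    then show "\<gamma> k = \<gamma> i \<otimes> \<gamma> j"
      using \<gamma>(1) by (intro inj_onD[OF bij_betw_imp_inj_on[OF f]]) auto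
  qed
qed

subsection \<open>The Frobenius--Perron character\<close>

context fusion_ring
begin

section \<open>Coordinates with respect to the basis\<close>

abbreviation coord where "coord \<equiv> basis_coord R n b"
abbreviation sc where "sc \<equiv> str_const R n b"

lemma b_carrier [simp, intro]: "i \<le> n \<Longrightarrow> b i \<in> carrier R"
  using basis by (auto simp: is_int_basis_def)

lemma coord_expansion:
  assumes "x \<in> carrier R"
  shows "x = (\<Oplus>k\<in>{..n}. add_pow R (coord x k) (b k))"
proof -
  have "\<exists>!a. a \<in> {..n} \<rightarrow>\<^sub>E (UNIV :: int set) \<and> x = (\<Oplus>k\<in>{..n}. add_pow R (a k) (b k))"
    using basis assms by (simp add: is_int_basis_def)
  from theI'[OF this] show ?thesis by (simp add: basis_coord_def)
qed

lemma coord_unique: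
  assumes "x = (\<Oplus>k\<in>{..n}. add_pow R (a k) (b k))" "k \<le> n"
  shows "coord x k = a k"
proof -
  have x: "x \<in> carrier R" unfolding assms(1) by (intro finsum_closed) auto
  then have ex1: "\<exists>!a. a \<in> {..n} \<rightarrow>\<^sub>E (UNIV :: int set) \<and> x = (\<Oplus>k\<in>{..n}. add_pow R (a k) (b k))"
    using basis by (simp add: is_int_basis_def)
  \<comment> \<open>Uniqueness in \<open>is_int_basis\<close> concerns extensional functions only,
    so \<open>a\<close> is first restricted.\<close>
  have "x = (\<Oplus>k\<in>{..n}. add_pow R (restrict a {..n} k) (b k))"
    unfolding assms(1) by (intro finsum_cong') auto
  then have "coord x = restrict a {..n}"
    unfolding basis_coord_def by (intro the1_equality[OF ex1]) auto
  then show ?thesis using assms(2) by simp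
qed

lemma coord_add:
  assumes "x \<in> carrier R" "y \<in> carrier R" "k \<le> n"
  shows "coord (x \<oplus> y) k = coord x k + coord y k"
proof (rule coord_unique[OF _ assms(3)])
  have "x \<oplus> y = (\<Oplus>k\<in>{..n}. add_pow R (coord x k) (b k)) \<oplus> (\<Oplus>k\<in>{..n}. add_pow R (coord y k) (b k))"
    using coord_expansion assms(1,2) by simp
  also have "\<dots> = (\<Oplus>k\<in>{..n}. add_pow R (coord x k) (b k) \<oplus> add_pow R (coord y k) (b k))"
    by (subst finsum_addf) auto
  also have "\<dots> = (\<Oplus>k\<in>{..n}. add_pow R (coord x k + coord y k) (b k))"
    by (intro finsum_cong') (auto simp: add.int_pow_mult)
  finally show "x \<oplus> y = (\<Oplus>k\<in>{..n}. add_pow R (coord x k + coord y k) (b k))" .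
qed

lemma coord_zero:
  assumes "k \<le> n"
  shows "coord \<zero> k = 0"
  using coord_add[of \<zero> \<zero> k] assms by simp

lemma coord_minus:
  assumes "x \<in> carrier R" "k \<le> n"
  shows "coord (\<ominus> x) k = - coord x k"
  using coord_add[of "\<ominus> x" x k] coord_zero assms by (simp add: l_neg)

lemma coord_add_pow:
  assumes x: "x \<in> carrier R" and k: "k \<le> n"
  shows "coord (add_pow R (m :: int) x) k = m * coord x k"
proof -
  have nat: "coord (add_pow R (m :: nat) x) k = int m * coord x k" for m
    by (induction m) (use x k in \<open>auto simp: coord_zero coord_add algebra_simps\<close>)
  show ?thesis
  proof (cases "0 \<le> m")
    case True
    then show ?thesis using nat by (simp add: add_pow_int_ge)
  next
    case False
    then show ?thesis using nat x k by (simp add: add_pow_int_lt coord_minus)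
  qed
qed

lemma coord_finsum:
  assumes "finite I" "f \<in> I \<rightarrow> carrier R" "k \<le> n"
  shows "coord (\<Oplus>i\<in>I. f i) k = (\<Sum>i\<in>I. coord (f i) k)"
  using assms
  by (induction I rule: finite_induct) (auto simp: coord_zero coord_add Pi_iff)

lemma coord_b:
  assumes "i \<le> n" "k \<le> n"
  shows "coord (b i) k = (if k = i then 1 else 0)"
proof (rule coord_unique[OF _ assms(2)])
  have "b i = (\<Oplus>k\<in>{..n}. if i = k then b k else \<zero>)"
    using assms by (subst finsum_singleton) auto
  also have "\<dots> = (\<Oplus>k\<in>{..n}. add_pow R ((if k = i then 1 else 0) :: int) (b k))"
    by (intro finsum_cong') (auto simp: add.int_pow_1 add_pow_def[of R "0 :: int"])
  finally show "b i = (\<Oplus>k\<in>{..n}. add_pow R ((if k = i then 1 else 0) :: int) (b k))" .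
qed

lemma inj_b: "inj_on b {..n}"
  by (rule inj_onI) (metis atMost_iff coord_b zero_neq_one)

section \<open>Unit, associativity and supports of structure constants\<close>

lemma sc_one:
  assumes "j \<le> n" "k \<le> n"
  shows "sc 0 j k = (if k = j then 1 else 0)"
  using assms by (simp add: str_const_def basis_one coord_b)

text \<open>Both sides are the coefficient of \<open>b k\<close> in the product of
  \<open>b x\<close>, \<open>b i\<close> and \<open>b j\<close>, bracketed in the two ways.\<close>

lemma sc_assoc:
  assumes "x \<le> n" "i \<le> n" "j \<le> n" "k \<le> n"
  shows "(\<Sum>m\<le>n. sc x i m * sc m j k) = (\<Sum>m\<le>n. sc i j m * sc x m k)"
proof -
  have "(b x \<otimes> b i) \<otimes> b j = (\<Oplus>m\<in>{..n}. add_pow R (sc x i m) (b m)) \<otimes> b j"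
    using coord_expansion[of "b x \<otimes> b i"] assms by (simp add: str_const_def)
  also have "\<dots> = (\<Oplus>m\<in>{..n}. add_pow R (sc x i m) (b m) \<otimes> b j)"
    using assms by (intro finsum_ldistr) auto
  also have "\<dots> = (\<Oplus>m\<in>{..n}. add_pow R (sc x i m) (b m \<otimes> b j))"
    using assms by (intro finsum_cong') (auto simp: add_pow_ldistr_int)
  finally have "coord ((b x \<otimes> b i) \<otimes> b j) k = (\<Sum>m\<le>n. sc x i m * sc m j k)"
    using assms by (simp add: coord_finsum coord_add_pow Pi_iff str_const_def)
  note left = this
  have "b x \<otimes> (b i \<otimes> b j) = b x \<otimes> (\<Oplus>m\<in>{..n}. add_pow R (sc i j m) (b m))"
    using coord_expansion[of "b i \<otimes> b j"] assms by (simp add: str_const_def)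
  also have "\<dots> = (\<Oplus>m\<in>{..n}. b x \<otimes> add_pow R (sc i j m) (b m))"
    using assms by (intro finsum_rdistr) auto
  also have "\<dots> = (\<Oplus>m\<in>{..n}. add_pow R (sc i j m) (b x \<otimes> b m))"
    using assms by (intro finsum_cong') (auto simp: add_pow_rdistr_int)
  finally have "coord (b x \<otimes> (b i \<otimes> b j)) k = (\<Sum>m\<le>n. sc i j m * sc x m k)"
    using assms by (simp add: coord_finsum coord_add_pow Pi_iff str_const_def)
  then show ?thesis using left assms by (simp add: m_assoc)
qed

text \<open>The coefficient of \<open>b k\<close> in \<open>(b i \<otimes> b i*) \<otimes> b k\<close> is positive, so it is positive in
  \<open>b i \<otimes> (b i* \<otimes> b k)\<close>.\<close>

lemma sc_transitive:
  assumes "i \<le> n" "k \<le> n"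
  obtains j where "j \<le> n" "0 < sc i j k"
proof -
  obtain s where s: "anti_involution R s" "s ` b ` {..n} \<subseteq> b ` {..n}"
    "\<And>i j. \<lbrakk>i \<le> n; j \<le> n\<rbrakk> \<Longrightarrow> sc i j 0 = (if b i = s (b j) then 1 else 0)"
    using duality by blast
  obtain i' where i': "i' \<le> n" "s (b i) = b i'" using s(2) assms(1) by blast
  have "s (b i') = b i" using s(1) i'(2) assms(1) by (metis anti_involution_def b_carrier)
  then have ii': "sc i i' 0 = 1" using s(3) i' assms by simp
  \<comment> \<open>The summand \<open>m = 0\<close> is \<open>1\<close>: \<open>b 0\<close> is the
    unit and occurs once in \<open>b i \<otimes> b i'\<close>.\<close>
  have "0 < (\<Sum>m\<le>n. sc i i' m * sc m k k)"
    by (rule sum_pos2[of _ 0])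
       (use ii' assms i' str_const_nonneg in \<open>auto simp: sc_one\<close>)
  then have "0 < (\<Sum>m\<le>n. sc i' k m * sc i m k)"
    using sc_assoc[OF assms(1) i'(1) assms(2) assms(2)] by simp
  then have "\<not> (\<forall>m\<in>{..n}. sc i' k m * sc i m k \<le> 0)"
    by (meson sum_nonpos not_le)
  then obtain m where "m \<le> n" "0 < sc i' k m * sc i m k" by (auto simp: not_le)
  then show ?thesis
    using that[of m] str_const_nonneg[of i' k m] i' assms by (simp add: zero_less_mult_iff)
qed

lemma positive_character:
  obtains d :: "nat \<Rightarrow> real" where "\<And>i. i \<le> n \<Longrightarrow> 0 < d i"
    and "\<And>i j. \<lbrakk>i \<le> n; j \<le> n\<rbrakk> \<Longrightarrow> (\<Sum>k\<le>n. of_int (sc i j k) * d k) = d i * d j"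
proof -
  \<comment> \<open>The coordinate matrix of right multiplication by the sum of all
    \<open>b j\<close>; it is positive since every \<open>b k\<close> occurs in some
    \<open>b i \<otimes> b j\<close>.\<close>
  define P :: "nat \<Rightarrow> nat \<Rightarrow> real" where "P k i = (\<Sum>j\<le>n. of_int (sc i j k))" for k i
  have P: "0 < P k i" if ki: "k \<le> n" "i \<le> n" for k i
  proof -
    obtain j where "j \<le> n" "0 < sc i j k" using sc_transitive[OF ki(2,1)] .
    then show ?thesis
      unfolding P_def using ki str_const_nonneg by (intro sum_pos2[of _ j]) auto
  qed
  obtain v t where v: "\<And>i. i \<le> n \<Longrightarrow> 0 < v i"
    "\<And>i. i \<le> n \<Longrightarrow> (\<Sum>j\<le>n. P i j * v j) = t * v i"
    using perron_eigenvector[of n P] P by blast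
  \<comment> \<open>Left multiplication by \<open>b x\<close> on real coordinate vectors. By
    \<open>sc_assoc\<close> it commutes with \<open>P\<close>, so it preserves the eigenspace of
    \<open>t\<close>, which is the line through \<open>v\<close>.\<close>
  define L where "L x u k = (\<Sum>i\<le>n. of_int (sc x i k) * (u i :: real))" for x u k
  have PL: "(\<Sum>k\<le>n. P l k * L x v k) = t * L x v l" if xl: "x \<le> n" "l \<le> n" for x l
  proof -
    have "(\<Sum>k\<le>n. P l k * L x v k) =
        (\<Sum>i\<le>n. \<Sum>j\<le>n. v i * of_int (\<Sum>k\<le>n. sc x i k * sc k j l))"
      unfolding P_def L_def sum_product sum_distrib_left sum_distrib_right of_int_sum
      by (subst sum.swap, rule sum.cong[OF refl], subst sum.swap)
         (auto intro!: sum.cong simp: algebra_simps)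
    also have "\<dots> = (\<Sum>i\<le>n. \<Sum>j\<le>n. v i * of_int (\<Sum>k\<le>n. sc i j k * sc x k l))"
      using xl by (simp add: sc_assoc)
    also have "\<dots> = (\<Sum>i\<le>n. \<Sum>j\<le>n. \<Sum>k\<le>n. v i * of_int (sc i j k * sc x k l))"
      by (simp add: sum_distrib_left)
    also have "\<dots> = (\<Sum>i\<le>n. \<Sum>k\<le>n. \<Sum>j\<le>n. v i * of_int (sc i j k * sc x k l))"
      by (intro sum.cong refl sum.swap)
    also have "\<dots> = (\<Sum>k\<le>n. \<Sum>i\<le>n. \<Sum>j\<le>n. v i * of_int (sc i j k * sc x k l))"
      by (rule sum.swap)
    also have "\<dots> = (\<Sum>k\<le>n. of_int (sc x k l) * (\<Sum>i\<le>n. P k i * v i))"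
      by (simp add: P_def sum_distrib_left sum_distrib_right algebra_simps)
    also have "\<dots> = t * L x v l"
      using v(2) by (simp add: L_def sum_distrib_left algebra_simps)
    finally show ?thesis .
  qed
  have "\<exists>s. \<forall>k\<le>n. L x v k = s * v k" if "x \<le> n" for x
    using perron_eigenvector_unique[OF P v PL[OF that]] by metis
  then obtain d where d: "\<And>x k. \<lbrakk>x \<le> n; k \<le> n\<rbrakk> \<Longrightarrow> L x v k = d x * v k"
    by metis
  show ?thesis
  proof (rule that[of d])
    fix x assume x: "x \<le> n"
    obtain i where "i \<le> n" "0 < sc x i 0" using sc_transitive[OF x, of 0] by blast
    then have "0 < L x v 0"
      unfolding L_def using x v(1) str_const_nonneg
      by (intro sum_pos2[of _ i]) (auto simp: less_imp_le)
    then show "0 < d x" using d[OF x, of 0] v(1)[of 0] by (simp add: zero_less_mult_iff)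
  next
    fix x y assume xy: "x \<le> n" "y \<le> n"
    \<comment> \<open>The coefficient of \<open>b 0\<close> in the product of \<open>b x\<close>,
      \<open>b y\<close> and \<open>v\<close> is computed in both bracketings.\<close>
    have "(\<Sum>k\<le>n. of_int (sc x y k) * d k) * v 0 = (\<Sum>k\<le>n. of_int (sc x y k) * L k v 0)"
      by (simp add: d sum_distrib_right mult.assoc)
    also have "\<dots> = (\<Sum>i\<le>n. v i * of_int (\<Sum>k\<le>n. sc x y k * sc k i 0))"
      unfolding L_def sum_distrib_left of_int_sum
      by (subst sum.swap) (auto intro!: sum.cong simp: algebra_simps)
    also have "\<dots> = (\<Sum>i\<le>n. v i * of_int (\<Sum>k\<le>n. sc y i k * sc x k 0))"
      using xy by (simp add: sc_assoc)
    also have "\<dots> = (\<Sum>k\<le>n. of_int (sc x k 0) * L y v k)"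
      unfolding L_def sum_distrib_left of_int_sum
      by (subst sum.swap) (auto intro!: sum.cong simp: algebra_simps)
    also have "\<dots> = d y * L x v 0"
      using xy by (simp add: d L_def[of x] sum_distrib_left algebra_simps)
    also have "\<dots> = d x * d y * v 0" using xy by (simp add: d)
    finally show "(\<Sum>k\<le>n. of_int (sc x y k) * d k) = d x * d y" using v(1)[of 0] by simp
  qed
qed

text \<open>Multiplicativity says that \<open>d\<close> is a positive eigenvector, with eigenvalue
  \<open>d i\<close>, of the matrix whose spectral radius defines
  \<open>FPdim_basis R n b i\<close>.\<close>

lemma FPdim_basis_character:
  obtains d :: "nat \<Rightarrow> real" where "\<And>i. i \<le> n \<Longrightarrow> 0 < d i"
    and "\<And>i j. \<lbrakk>i \<le> n; j \<le> n\<rbrakk> \<Longrightarrow> (\<Sum>k\<le>n. of_int (sc i j k) * d k) = d i * d j"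
    and "\<And>i. i \<le> n \<Longrightarrow> FPdim_basis R n b i = of_real (d i)"
proof -
  obtain d :: "nat \<Rightarrow> real" where d: "\<And>i. i \<le> n \<Longrightarrow> 0 < d i"
    "\<And>i j. \<lbrakk>i \<le> n; j \<le> n\<rbrakk> \<Longrightarrow> (\<Sum>k\<le>n. of_int (sc i j k) * d k) = d i * d j"
    using positive_character by blast
  have "FPdim_basis R n b i = of_real (d i)" if i: "i \<le> n" for i
  proof -
    have "spectral_radius (mat (Suc n) (Suc n) (\<lambda>(j, k). complex_of_real (of_int (sc i j k)))) = d i"
      by (rule spectral_radius_positive_eigenvector[of n _ d])
         (use i d str_const_nonneg in auto)
    then show ?thesis by (simp add: FPdim_basis_def)
  qed
  with d show ?thesis by (rule that)
qed

text \<open>A product without constituents would give \<open>d i * d j = 0\<close>, against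
  positivity of the character.\<close>

lemma sc_nonzero:
  assumes "i \<le> n" "j \<le> n"
  shows "\<exists>k\<le>n. 0 < sc i j k"
proof (rule ccontr)
  assume "\<not> (\<exists>k\<le>n. 0 < sc i j k)"
  then have "sc i j k = 0" if "k \<le> n" for k
    using that str_const_nonneg[OF assms that] by force
  then have 0: "(\<Sum>k\<le>n. of_int (sc i j k) * d k) = 0" for d :: "nat \<Rightarrow> real" by simp
  obtain d :: "nat \<Rightarrow> real" where d: "\<And>i. i \<le> n \<Longrightarrow> 0 < d i"
    "\<And>i j. \<lbrakk>i \<le> n; j \<le> n\<rbrakk> \<Longrightarrow> (\<Sum>k\<le>n. of_int (sc i j k) * d k) = d i * d j"
    using positive_character by blast
  show False using d(1)[OF assms(1)] d(1)[OF assms(2)] d(2)[OF assms] 0[of d] by simp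
qed

lemma FPdim_b: "i \<le> n \<Longrightarrow> FPdim R n b (b i) = FPdim_basis R n b i"
  by (simp add: FPdim_def coord_b if_distrib[of of_int] if_distrib[of "\<lambda>x. x * _"] sum.delta cong: if_cong)

end

subsection \<open>Automorphisms of generated fields\<close>

lemma complex_field_simps [simp]:
  "carrier complex_field = UNIV" "\<zero>\<^bsub>complex_field\<^esub> = 0" "\<one>\<^bsub>complex_field\<^esub> = 1"
  "x \<oplus>\<^bsub>complex_field\<^esub> y = x + y" "x \<otimes>\<^bsub>complex_field\<^esub> y = x * y"
  by (simp_all add: ring_of_type_algebra_def)

lemma complex_field_minus [simp]: "\<ominus>\<^bsub>complex_field\<^esub> x = - x"
proof -
  interpret C: field complex_field by (rule field_from_type_algebra)
  show ?thesis by (rule C.minus_equality) auto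
qed

lemma complex_field_inv [simp]: "x \<noteq> 0 \<Longrightarrow> inv\<^bsub>complex_field\<^esub> x = inverse x"
proof -
  interpret C: field complex_field by (rule field_from_type_algebra)
  assume "x \<noteq> 0"
  then show ?thesis by (intro C.comm_inv_char) auto
qed

lemma generate_field_subset:
  assumes "S \<subseteq> generate_field R T"
  shows "generate_field R S \<subseteq> generate_field R T"
proof
  fix x assume "x \<in> generate_field R S"
  then show "x \<in> generate_field R T"
    by (induction rule: generate_field.induct) (use assms in \<open>blast intro: generate_field.intros\<close>)+
qed

lemma generate_field_0: "0 \<in> generate_field complex_field S"
proof -
  have "1 + - 1 \<in> generate_field complex_field S"
    using generate_field.one[of complex_field S]
      generate_field.a_inv[of 1 complex_field S] generate_field.eng_add[of 1 complex_field S "- 1"]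
    by simp
  then show ?thesis by simp
qed

lemma generate_field_of_int: "of_int m \<in> generate_field complex_field S"
proof (induction m rule: int_induct[of _ 0])
  case base
  show ?case by (simp add: generate_field_0)
next
  case (step1 i)
  then show ?case
    using generate_field.eng_add[OF step1(2) generate_field.one] by simp
next
  case (step2 i)
  then show ?case
    using generate_field.eng_add[OF step2(2) generate_field.a_inv[OF generate_field.one]] by simp
qed

lemma generate_field_sum:
  "(\<And>i. i \<in> I \<Longrightarrow> f i \<in> generate_field complex_field S) \<Longrightarrow>
    (\<Sum>i\<in>I. f i) \<in> generate_field complex_field S"
proof (induction I rule: infinite_finite_induct)
  case (insert i I)
  then show ?case using generate_field.eng_add[of "f i" complex_field S "sum f I"] by simp
qed (simp_all add: generate_field_0)

section \<open>The Galois group and its action on generators\<close>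

lemma carrier_Gal_iff:
  "\<sigma> \<in> carrier (Gal L K) \<longleftrightarrow> \<sigma> \<in> extensional L \<and> bij_betw \<sigma> L L \<and>
     (\<forall>x\<in>L. \<forall>y\<in>L. \<sigma> (x + y) = \<sigma> x + \<sigma> y) \<and> (\<forall>x\<in>L. \<forall>y\<in>L. \<sigma> (x * y) = \<sigma> x * \<sigma> y) \<and>
     \<sigma> 1 = 1 \<and> (\<forall>x\<in>K. \<sigma> x = x)"
  by (auto simp: Gal_def Bij_def ring_iso_def Ring.ring_hom_def bij_betw_def)

lemma Gal_mult:
  assumes "\<sigma> \<in> carrier (Gal L K)" "\<tau> \<in> carrier (Gal L K)" "x \<in> L"
  shows "(\<sigma> \<otimes>\<^bsub>Gal L K\<^esub> \<tau>) x = \<sigma> (\<tau> x)"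
  using assms by (auto simp: Gal_def BijGroup_def compose_def)

lemma Gal_mult_closed:
  assumes \<sigma>: "\<sigma> \<in> carrier (Gal L K)" and \<tau>: "\<tau> \<in> carrier (Gal L K)"
    and L: "1 \<in> L" "K \<subseteq> L" "\<And>x y. \<lbrakk>x \<in> L; y \<in> L\<rbrakk> \<Longrightarrow> x + y \<in> L \<and> x * y \<in> L"
  shows "\<sigma> \<otimes>\<^bsub>Gal L K\<^esub> \<tau> \<in> carrier (Gal L K)"
proof -
  have eq: "\<sigma> \<otimes>\<^bsub>Gal L K\<^esub> \<tau> = compose L \<sigma> \<tau>"
    using assms by (auto simp: Gal_def BijGroup_def)
  have \<tau>L: "\<tau> x \<in> L" if "x \<in> L" for x
    using \<tau> that by (auto simp: carrier_Gal_iff bij_betw_def)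
  have "bij_betw (compose L \<sigma> \<tau>) L L"
    using \<sigma> \<tau> by (auto simp: carrier_Gal_iff intro: bij_betw_compose)
  moreover have "compose L \<sigma> \<tau> x = x" if "x \<in> K" for x
    using that L(2) \<sigma> \<tau> by (auto simp: compose_def carrier_Gal_iff)
  ultimately show ?thesis
    unfolding eq carrier_Gal_iff
    using \<sigma> \<tau> L \<tau>L by (auto simp: carrier_Gal_iff compose_def)
qed

lemma Gal_one: "\<one>\<^bsub>Gal L K\<^esub> = (\<lambda>x\<in>L. x)"
  by (simp add: Gal_def BijGroup_def)

lemma Gal_one_closed:
  assumes "1 \<in> L" "K \<subseteq> L" "\<And>x y. \<lbrakk>x \<in> L; y \<in> L\<rbrakk> \<Longrightarrow> x + y \<in> L \<and> x * y \<in> L"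
  shows "\<one>\<^bsub>Gal L K\<^esub> \<in> carrier (Gal L K)"
  unfolding Gal_one carrier_Gal_iff using assms by (auto simp: bij_betw_def inj_on_def)

text \<open>When every automorphism squares to the identity, each is its own inverse, and only
  closure under composition remains to be used.\<close>

lemma Gal_group_of_involutions:
  assumes L: "1 \<in> L" "K \<subseteq> L" "\<And>x y. \<lbrakk>x \<in> L; y \<in> L\<rbrakk> \<Longrightarrow> x + y \<in> L \<and> x * y \<in> L"
    and inv: "\<And>\<sigma>. \<sigma> \<in> carrier (Gal L K) \<Longrightarrow> \<sigma> \<otimes>\<^bsub>Gal L K\<^esub> \<sigma> = \<one>\<^bsub>Gal L K\<^esub>"
  shows "group (Gal L K)"
proof (rule groupI)
  fix x y z
  assume xyz: "x \<in> carrier (Gal L K)" "y \<in> carrier (Gal L K)" "z \<in> carrier (Gal L K)"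
  then show "x \<otimes>\<^bsub>Gal L K\<^esub> y \<otimes>\<^bsub>Gal L K\<^esub> z = x \<otimes>\<^bsub>Gal L K\<^esub> (y \<otimes>\<^bsub>Gal L K\<^esub> z)"
  proof (intro extensionalityI[of _ L])
    fix a assume a: "a \<in> L"
    moreover from this xyz have "z a \<in> L" by (auto simp: carrier_Gal_iff bij_betw_def)
    ultimately show "(x \<otimes>\<^bsub>Gal L K\<^esub> y \<otimes>\<^bsub>Gal L K\<^esub> z) a = (x \<otimes>\<^bsub>Gal L K\<^esub> (y \<otimes>\<^bsub>Gal L K\<^esub> z)) a"
      using xyz by (simp add: Gal_mult Gal_mult_closed[OF _ _ L])
  qed (use Gal_mult_closed[OF _ _ L] in \<open>simp_all add: carrier_Gal_iff\<close>)
next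
  fix x assume x: "x \<in> carrier (Gal L K)"
  then show "\<one>\<^bsub>Gal L K\<^esub> \<otimes>\<^bsub>Gal L K\<^esub> x = x"
  proof (intro extensionalityI[of _ L])
    fix a assume a: "a \<in> L"
    moreover from this x have "x a \<in> L" by (auto simp: carrier_Gal_iff bij_betw_def)
    ultimately show "(\<one>\<^bsub>Gal L K\<^esub> \<otimes>\<^bsub>Gal L K\<^esub> x) a = x a"
      using x by (simp add: Gal_mult Gal_one_closed[OF L]) (simp add: Gal_one)
  qed (use Gal_mult_closed[OF _ _ L] Gal_one_closed[OF L] in \<open>simp_all add: carrier_Gal_iff\<close>)
  show "\<exists>y\<in>carrier (Gal L K). y \<otimes>\<^bsub>Gal L K\<^esub> x = \<one>\<^bsub>Gal L K\<^esub>" using inv x by blast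
qed (use L in \<open>auto intro: Gal_mult_closed Gal_one_closed\<close>)

text \<open>Induction along the generation of the field; compatibility with negation and inversion
  follows from additivity and multiplicativity.\<close>

lemma Gal_eqI:
  assumes \<sigma>: "\<sigma> \<in> carrier (Gal (generate_field complex_field S) K)"
    and \<tau>: "\<tau> \<in> carrier (Gal (generate_field complex_field S) K)"
    and S: "\<And>x. x \<in> S \<Longrightarrow> \<sigma> x = \<tau> x"
  shows "\<sigma> = \<tau>"
proof (rule extensionalityI)
  let ?L = "generate_field complex_field S"
  show "\<sigma> \<in> extensional ?L" "\<tau> \<in> extensional ?L" using \<sigma> \<tau> by (auto simp: carrier_Gal_iff)
  have minus: "\<rho> (- x) = - \<rho> x" if \<rho>: "\<rho> \<in> carrier (Gal ?L K)" "x \<in> ?L" for \<rho> x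
  proof -
    have "- x \<in> ?L" using generate_field.a_inv[OF that(2)] by simp
    then have "\<rho> (x + - x) = \<rho> x + \<rho> (- x)" "\<rho> (0 + 0) = \<rho> 0 + \<rho> 0"
      using \<rho> generate_field_0[of S] unfolding carrier_Gal_iff by blast+
    then show ?thesis by (simp add: eq_neg_iff_add_eq_0 add.commute)
  qed
  have inverse: "\<rho> (inverse x) = inverse (\<rho> x)"
    if \<rho>: "\<rho> \<in> carrier (Gal ?L K)" "x \<in> ?L" "x \<noteq> 0" for \<rho> x
  proof -
    have "inverse x \<in> ?L" using generate_field.m_inv[OF that(2)] that(3) by simp
    then have "\<rho> (x * inverse x) = \<rho> x * \<rho> (inverse x)" "\<rho> 1 = 1"
      using \<rho> unfolding carrier_Gal_iff by blast+
    then show ?thesis using that(3) by (simp add: inverse_unique)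
  qed
  fix x assume "x \<in> ?L"
  then show "\<sigma> x = \<tau> x"
  proof (induction rule: generate_field.induct)
    case one
    then show ?case using \<sigma> \<tau> by (simp add: carrier_Gal_iff)
  next
    case (incl h)
    then show ?case by (rule S)
  next
    case (a_inv h)
    then show ?case by (simp add: minus \<sigma> \<tau>)
  next
    case (m_inv h)
    then show ?case by (simp add: inverse \<sigma> \<tau>)
  next
    case (eng_add h1 h2)
    then show ?case using \<sigma> \<tau> by (simp add: carrier_Gal_iff)
  next
    case (eng_mult h1 h2)
    then show ?case using \<sigma> \<tau> by (simp add: carrier_Gal_iff)
  qed
qed

lemma Gal_of_int:
  assumes \<sigma>: "\<sigma> \<in> carrier (Gal (generate_field complex_field S) K)"
  shows "\<sigma> (of_int m) = of_int m"
proof -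
  let ?L = "generate_field complex_field S"
  have add: "\<sigma> (x + y) = \<sigma> x + \<sigma> y" if "x \<in> ?L" "y \<in> ?L" for x y
    using \<sigma> that by (simp add: carrier_Gal_iff)
  have one: "\<sigma> 1 = 1" "1 \<in> ?L" using \<sigma> generate_field.one[of complex_field S] by (auto simp: carrier_Gal_iff)
  show ?thesis
  proof (induction m rule: int_induct[of _ 0])
    case base
    show ?case using add[of 0 0] by (simp add: generate_field_0)
  next
    case (step1 i)
    then show ?case using add[of "of_int i" 1] one by (simp add: generate_field_of_int)
  next
    case (step2 i)
    then show ?case using add[of "of_int (i - 1)" 1] one generate_field_of_int[of "i - 1" S]
      by (simp add: algebra_simps)
  qed
qed

text \<open>Values of \<open>FPdim\<close> and the character equations are integer combinations;
  this carries them through \<open>\<sigma>\<close>.\<close>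

lemma Gal_of_int_combination:
  assumes \<sigma>: "\<sigma> \<in> carrier (Gal (generate_field complex_field S) K)"
    and f: "\<And>i. i \<in> I \<Longrightarrow> f i \<in> generate_field complex_field S"
  shows "\<sigma> (\<Sum>i\<in>I. of_int (m i) * f i) = (\<Sum>i\<in>I. of_int (m i) * \<sigma> (f i))"
  using f
proof (induction I rule: infinite_finite_induct)
  case (insert i I)
  have mf: "of_int (m j) * f j \<in> generate_field complex_field S" if "j \<in> insert i I" for j
    using generate_field.eng_mult[OF generate_field_of_int insert.prems[OF that]] by simp
  then have "\<sigma> (of_int (m i) * f i + (\<Sum>i\<in>I. of_int (m i) * f i))
      = \<sigma> (of_int (m i) * f i) + \<sigma> (\<Sum>i\<in>I. of_int (m i) * f i)"
    using \<sigma> generate_field_sum[of I "\<lambda>i. of_int (m i) * f i" S] by (simp add: carrier_Gal_iff)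
  also have "\<sigma> (of_int (m i) * f i) = of_int (m i) * \<sigma> (f i)"
    using \<sigma> insert.prems[of i] generate_field_of_int[of "m i" S] Gal_of_int[OF \<sigma>, of "m i"]
    by (simp add: carrier_Gal_iff)
  finally show ?case using insert by simp
qed (use Gal_of_int[OF \<sigma>, of 0] in simp_all)

text \<open>Each \<open>Re ((s i)\<^sup>2)\<close> is at most \<open>(d i)\<^sup>2\<close> and the
  sums agree, so equality holds termwise. The norm bound then leaves no room for an imaginary part,
  and the squares coincide.\<close>

lemma eq_or_eq_minus_of_sum_squares_eq:
  fixes s :: "'i \<Rightarrow> complex" and d :: "'i \<Rightarrow> real"
  assumes I: "finite I" "i \<in> I"
    and le: "\<And>i. i \<in> I \<Longrightarrow> norm (s i) \<le> d i"
    and sum: "(\<Sum>i\<in>I. (s i)\<^sup>2) = (\<Sum>i\<in>I. (of_real (d i))\<^sup>2)"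
  shows "s i = of_real (d i) \<or> s i = - of_real (d i)"
proof -
  have norm_le: "norm ((s i)\<^sup>2) \<le> (d i)\<^sup>2" if "i \<in> I" for i
    using le[OF that] by (simp add: norm_power power_mono)
  have Re_le: "Re ((s i)\<^sup>2) \<le> (d i)\<^sup>2" if "i \<in> I" for i
    using norm_le[OF that] complex_Re_le_cmod order_trans by blast
  have "(\<Sum>i\<in>I. Re ((s i)\<^sup>2)) = (\<Sum>i\<in>I. (d i)\<^sup>2)"
    using arg_cong[OF sum, of Re] by (simp add: Re_sum flip: of_real_power)
  then have "(\<Sum>i\<in>I. (d i)\<^sup>2 - Re ((s i)\<^sup>2)) = 0" by (simp only: sum_subtractf)
  then have Re: "Re ((s i)\<^sup>2) = (d i)\<^sup>2"
    using sum_nonneg_eq_0_iff[of I "\<lambda>i. (d i)\<^sup>2 - Re ((s i)\<^sup>2)"] Re_le I by auto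
  have "(norm ((s i)\<^sup>2))\<^sup>2 \<le> ((d i)\<^sup>2)\<^sup>2"
    using norm_le[OF I(2)] by (intro power_mono) auto
  then have "(Im ((s i)\<^sup>2))\<^sup>2 \<le> 0"
    unfolding cmod_power2 Re by simp
  then have "Im ((s i)\<^sup>2) = 0" by simp
  with Re have "(s i)\<^sup>2 = (of_real (d i))\<^sup>2"
    by (intro complex_eqI) (simp_all flip: of_real_power)
  then show ?thesis by (rule power2_eq_iff[THEN iffD1])
qed

subsection \<open>The grading\<close>

context fusion_ring
begin

text \<open>This supplies the combinatorial data for \<open>onto_grading_of_sign_patterns\<close>:
  \<open>E \<sigma>\<close> collects the indices whose dimension changes sign under
  \<open>\<sigma>\<close>.\<close>

lemma Gal_sign_patterns:
  obtains E :: "(complex \<Rightarrow> complex) \<Rightarrow> nat set"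
  where "group (Gal (K1 R n b) (K0 R n b))"
    and "\<And>\<sigma>. \<sigma> \<in> carrier (Gal (K1 R n b) (K0 R n b)) \<Longrightarrow> E \<sigma> \<subseteq> {..n}"
    and "inj_on E (carrier (Gal (K1 R n b) (K0 R n b)))"
    and "\<And>\<sigma> \<tau>. \<lbrakk>\<sigma> \<in> carrier (Gal (K1 R n b) (K0 R n b)); \<tau> \<in> carrier (Gal (K1 R n b) (K0 R n b))\<rbrakk> \<Longrightarrow>
      E (\<sigma> \<otimes>\<^bsub>Gal (K1 R n b) (K0 R n b)\<^esub> \<tau>) = sym_diff (E \<sigma>) (E \<tau>)"
    and "\<And>\<sigma> i j k. \<lbrakk>\<sigma> \<in> carrier (Gal (K1 R n b) (K0 R n b)); i \<le> n; j \<le> n; k \<le> n; 0 < sc i j k\<rbrakk> \<Longrightarrow>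
      k \<in> E \<sigma> \<longleftrightarrow> (i \<in> E \<sigma>) \<noteq> (j \<in> E \<sigma>)"
proof -
  obtain d :: "nat \<Rightarrow> real" where d_pos: "\<And>i. i \<le> n \<Longrightarrow> 0 < d i"
    and d_mult: "\<And>i j. \<lbrakk>i \<le> n; j \<le> n\<rbrakk> \<Longrightarrow> (\<Sum>k\<le>n. of_int (sc i j k) * d k) = d i * d j"
    and d: "\<And>i. i \<le> n \<Longrightarrow> FPdim_basis R n b i = of_real (d i)"
    using FPdim_basis_character by blast
  define D where "D i = complex_of_real (d i)" for i
  define S where "S = FPdim R n b ` carrier R"
  define L where "L = generate_field complex_field S"
  define K where "K = K0 R n b"
  have K1_eq: "K1 R n b = L" by (simp add: K1_def L_def S_def)
  have D_mult: "(\<Sum>k\<le>n. of_int (sc i j k) * D k) = D i * D j" if "i \<le> n" "j \<le> n" for i j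
    using arg_cong[OF d_mult[OF that], of complex_of_real] by (simp add: D_def)
  have D_nz: "D i \<noteq> 0" if "i \<le> n" for i using d_pos[OF that] by (simp add: D_def)
  \<comment> \<open>\<open>D 0\<close> is a nonzero idempotent because \<open>b 0\<close> is the
    unit.\<close>
  have D_0: "D 0 = 1" using D_mult[of 0 0] D_nz[of 0]
    by (simp add: sc_one if_distrib[of of_int] if_distrib[of "\<lambda>x. x * _"] cong: if_cong)
  have DL: "D i \<in> L" if "i \<le> n" for i
    unfolding L_def S_def
    by (rule generate_field.incl)
       (use that in \<open>auto simp: D_def d FPdim_b intro: image_eqI[of _ _ "b i"]\<close>)
  have L_1: "1 \<in> L" unfolding L_def using generate_field.one[of complex_field S] by simp
  have L: "x + y \<in> L \<and> x * y \<in> L" if "x \<in> L" "y \<in> L" for x y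
    using that generate_field.eng_add[of x complex_field S y]
      generate_field.eng_mult[of x complex_field S y] by (auto simp: L_def)
  have dim: "FPdim_ring R n b = (\<Sum>i\<le>n. D i * D i)"
    by (simp add: FPdim_ring_def FPdim_b d D_def power2_eq_square)
  have dimL: "(\<Sum>i\<le>n. D i * D i) \<in> L"
    unfolding L_def by (rule generate_field_sum) (use DL L in \<open>auto simp: L_def\<close>)
  have KL: "K \<subseteq> L"
    unfolding K_def K0_def L_def
    by (rule generate_field_subset) (use dim dimL in \<open>simp add: L_def\<close>)
  have dimK: "(\<Sum>i\<le>n. D i * D i) \<in> K"
    unfolding K_def K0_def dim by (rule generate_field.incl) simp

  have Gal_times: "\<sigma> (x * y) = \<sigma> x * \<sigma> y"
    if "\<sigma> \<in> carrier (Gal L K)" "x \<in> L" "y \<in> L" for \<sigma> x y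
    using that by (auto simp: carrier_Gal_iff)
  have Gal_comb: "\<sigma> (\<Sum>i\<in>I. of_int (m i) * f i) = (\<Sum>i\<in>I. of_int (m i) * \<sigma> (f i))"
    if "\<sigma> \<in> carrier (Gal L K)" "\<And>i. i \<in> I \<Longrightarrow> f i \<in> L" for \<sigma> m f and I :: "nat set"
    using that unfolding L_def by (rule Gal_of_int_combination)
  have \<sigma>D_mult: "(\<Sum>k\<le>n. of_int (sc i j k) * \<sigma> (D k)) = \<sigma> (D i) * \<sigma> (D j)"
    if \<sigma>: "\<sigma> \<in> carrier (Gal L K)" and ij: "i \<le> n" "j \<le> n" for \<sigma> i j
  proof -
    have "(\<Sum>k\<le>n. of_int (sc i j k) * \<sigma> (D k)) = \<sigma> (\<Sum>k\<le>n. of_int (sc i j k) * D k)"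
      using Gal_comb[OF \<sigma>, of "{..n}" D "sc i j"] DL by simp
    also have "\<dots> = \<sigma> (D i) * \<sigma> (D j)"
      using ij by (simp add: D_mult Gal_times[OF \<sigma>] DL)
    finally show ?thesis .
  qed
  have \<sigma>D: "\<sigma> (D i) = D i \<or> \<sigma> (D i) = - D i"
    if \<sigma>: "\<sigma> \<in> carrier (Gal L K)" and i: "i \<le> n" for \<sigma> i
  proof -
    have "norm (\<sigma> (D i)) \<le> d i" if "i \<in> {..n}" for i
    \<comment> \<open>The conjugated dimensions form an eigenvector, with eigenvalue
      \<open>\<sigma> (D i)\<close>, of a matrix for which \<open>d\<close> is a positive
      eigenvector with eigenvalue \<open>d i\<close>. Its entry at \<open>0\<close> is
      \<open>1\<close>.\<close>
    proof (rule eigenvalue_norm_le_positive_eigenvalue[of n "\<lambda>j k. of_int (sc i j k)" d _ "\<lambda>k. \<sigma> (D k)" _ 0])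
      show "\<sigma> (D 0) \<noteq> 0" using \<sigma> by (simp add: D_0 carrier_Gal_iff)
    qed (use that d_pos d_mult \<sigma>D_mult[OF \<sigma>] str_const_nonneg in auto)
    moreover have "(\<Sum>i\<le>n. (\<sigma> (D i))\<^sup>2) = (\<Sum>i\<le>n. (of_real (d i))\<^sup>2)"
    proof -
      have "(\<Sum>i\<le>n. (\<sigma> (D i))\<^sup>2) = \<sigma> (\<Sum>i\<le>n. D i * D i)"
        using Gal_comb[OF \<sigma>, of "{..n}" "\<lambda>i. D i * D i" "\<lambda>_. 1"] DL L
        by (simp add: Gal_times[OF \<sigma>] power2_eq_square)
      \<comment> \<open>This number is \<open>FPdim_ring R n b\<close>, the generator of
        \<open>K\<close>, hence fixed.\<close>
      also have "\<dots> = (\<Sum>i\<le>n. D i * D i)"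
        using \<sigma> dimK by (simp add: carrier_Gal_iff)
      finally show ?thesis by (simp add: D_def power2_eq_square)
    qed
    ultimately show ?thesis
      using eq_or_eq_minus_of_sum_squares_eq[of "{..n}" i "\<lambda>i. \<sigma> (D i)" d] i by (simp add: D_def)
  qed
  have \<sigma>_minus: "\<sigma> (- D i) = - \<sigma> (D i)"
    if "\<sigma> \<in> carrier (Gal L K)" "i \<le> n" for \<sigma> i
    using Gal_comb[OF that(1), of "{i}" D "\<lambda>_. - 1"] DL that(2) by simp

  define E where "E \<sigma> = {i. i \<le> n \<and> \<sigma> (D i) \<noteq> D i}" for \<sigma> :: "complex \<Rightarrow> complex"
  have \<sigma>D_E: "\<sigma> (D i) = (if i \<in> E \<sigma> then - D i else D i)"
    if "\<sigma> \<in> carrier (Gal L K)" "i \<le> n" for \<sigma> i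
    using \<sigma>D[OF that] that(2) by (auto simp: E_def)
  have E_mult: "E (\<sigma> \<otimes>\<^bsub>Gal L K\<^esub> \<tau>) = sym_diff (E \<sigma>) (E \<tau>)"
    if "\<sigma> \<in> carrier (Gal L K)" "\<tau> \<in> carrier (Gal L K)" for \<sigma> \<tau>
  proof -
    have "i \<in> E (\<sigma> \<otimes>\<^bsub>Gal L K\<^esub> \<tau>) \<longleftrightarrow> (i \<in> E \<sigma>) \<noteq> (i \<in> E \<tau>)" if i: "i \<le> n" for i
    proof -
      have "i \<in> E (\<sigma> \<otimes>\<^bsub>Gal L K\<^esub> \<tau>) \<longleftrightarrow> \<sigma> (\<tau> (D i)) \<noteq> D i"
        using i DL[OF i] \<open>\<sigma> \<in> _\<close> \<open>\<tau> \<in> _\<close> by (simp add: E_def[of "_ \<otimes>\<^bsub>_\<^esub> _"] Gal_mult)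
      also have "\<dots> \<longleftrightarrow> (i \<in> E \<sigma>) \<noteq> (i \<in> E \<tau>)"
        using D_nz[OF i] \<sigma>D_E[OF \<open>\<sigma> \<in> _\<close> i] \<sigma>D_E[OF \<open>\<tau> \<in> _\<close> i] \<sigma>_minus[OF \<open>\<sigma> \<in> _\<close> i] by auto
      finally show ?thesis .
    qed
    moreover have "E \<rho> \<subseteq> {..n}" for \<rho> by (auto simp: E_def)
    ultimately show ?thesis by blast
  qed
  have E_inj: "\<sigma> = \<tau>"
    if \<sigma>: "\<sigma> \<in> carrier (Gal L K)" and \<tau>: "\<tau> \<in> carrier (Gal L K)" and eq: "E \<sigma> = E \<tau>" for \<sigma> \<tau>
  proof (rule Gal_eqI[OF \<sigma>[unfolded L_def] \<tau>[unfolded L_def]])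
    \<comment> \<open>The generators are integer combinations of the \<open>D k\<close>, so the
      signs determine the automorphism.\<close>
    fix x assume "x \<in> S"
    then obtain y where "x = FPdim R n b y" by (auto simp: S_def)
    then have x: "x = (\<Sum>k\<le>n. of_int (coord y k) * D k)" by (simp add: FPdim_def d D_def)
    have "\<sigma> x = (\<Sum>k\<le>n. of_int (coord y k) * \<sigma> (D k))"
      unfolding x using DL by (intro Gal_comb[OF \<sigma>]) auto
    also have "\<dots> = (\<Sum>k\<le>n. of_int (coord y k) * \<tau> (D k))"
      by (intro sum.cong refl) (simp add: \<sigma>D_E[OF \<sigma>] \<sigma>D_E[OF \<tau>] eq)
    also have "\<dots> = \<tau> x"
      unfolding x using DL by (intro Gal_comb[OF \<tau>, symmetric]) auto
    finally show "\<sigma> x = \<tau> x" .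
  qed
  have grp: "group (Gal L K)"
  proof (rule Gal_group_of_involutions[OF L_1 KL L])
    fix \<sigma> assume \<sigma>: "\<sigma> \<in> carrier (Gal L K)"
    \<comment> \<open>The square of \<open>\<sigma>\<close> has the empty sign set of the identity,
      so injectivity of \<open>E\<close> makes \<open>\<sigma>\<close> an involution.\<close>
    have "E \<one>\<^bsub>Gal L K\<^esub> = {}" using DL by (auto simp: E_def Gal_one)
    then have "E (\<sigma> \<otimes>\<^bsub>Gal L K\<^esub> \<sigma>) = E \<one>\<^bsub>Gal L K\<^esub>"
      using E_mult[OF \<sigma> \<sigma>] by simp
    then show "\<sigma> \<otimes>\<^bsub>Gal L K\<^esub> \<sigma> = \<one>\<^bsub>Gal L K\<^esub>"
      by (intro E_inj Gal_mult_closed Gal_one_closed \<sigma> L_1 KL L)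
  qed
  have E_sc: "k \<in> E \<sigma> \<longleftrightarrow> (i \<in> E \<sigma>) \<noteq> (j \<in> E \<sigma>)"
    if \<sigma>: "\<sigma> \<in> carrier (Gal L K)" and ijk: "i \<le> n" "j \<le> n" "k \<le> n" "0 < sc i j k" for \<sigma> i j k
  proof -
    define e where "e i = (if i \<in> E \<sigma> then - 1 else 1 :: real)" for i
    have \<sigma>e: "\<sigma> (D i) = of_real (e i * d i)" if "i \<le> n" for i
      using \<sigma>D_E[OF \<sigma> that] by (simp add: e_def D_def)
    have "complex_of_real (\<Sum>k\<le>n. of_int (sc i j k) * (e k * d k)) = of_real ((e i * d i) * (e j * d j))"
      using \<sigma>D_mult[OF \<sigma> ijk(1,2)] ijk(1,2) by (simp add: \<sigma>e)
    then have "(\<Sum>k\<le>n. of_int (sc i j k) * (e k * d k)) = e i * e j * (d i * d j)"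
      unfolding of_real_eq_iff by simp
    also have "\<dots> = (\<Sum>k\<le>n. of_int (sc i j k) * (e i * e j * d k))"
      unfolding d_mult[OF ijk(1,2), symmetric] by (simp add: sum_distrib_left mult_ac)
    finally have eq: "(\<Sum>k\<le>n. of_int (sc i j k) * (e k * d k))
      = (\<Sum>k\<le>n. of_int (sc i j k) * (e i * e j * d k))" .
    have ee: "e i * e j * (e i * e j) = 1" and le1: "e i * e j * e k \<le> 1" for k by (auto simp: e_def)
    \<comment> \<open>Comparing the character equations for \<open>d\<close> and for its signed
      version makes this sum vanish. Its terms are nonnegative, so
      \<open>e i * e j * e k = 1\<close> wherever the structure constant is positive.\<close>
    have "(\<Sum>k\<le>n. of_int (sc i j k) * ((1 - e i * e j * e k) * d k)) =
        (e i * e j * (e i * e j)) * (\<Sum>k\<le>n. of_int (sc i j k) * d k)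
        - e i * e j * (\<Sum>k\<le>n. of_int (sc i j k) * (e k * d k))"
      unfolding ee by (simp add: sum_distrib_left sum_subtractf algebra_simps)
    also have "\<dots> = 0" unfolding eq by (simp add: sum_distrib_left mult_ac)
    finally have "\<forall>k\<in>{..n}. of_int (sc i j k) * ((1 - e i * e j * e k) * d k) = 0"
      using ijk le1 d_pos str_const_nonneg
      by (subst (asm) sum_nonneg_eq_0_iff) (auto intro!: mult_nonneg_nonneg simp: less_imp_le)
    then have "of_int (sc i j k) * ((1 - e i * e j * e k) * d k) = 0" using ijk(3) by blast
    then have "e i * e j * e k = 1" using ijk d_pos[OF ijk(3)] by simp
    then show ?thesis by (auto simp: e_def split: if_splits)
  qed
  show ?thesis
    by (rule that[of E, unfolded K1_eq, folded K_def])
       (use grp E_inj E_mult E_sc in \<open>auto simp: inj_on_def E_def[abs_def]\<close>)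
qed

text \<open>Surjectivity of \<open>\<gamma>\<close> gives finiteness of the group and faithfulness;
  multiplicativity on constituents confines products to the right component.\<close>

lemma faithful_grading_of_index_grading:
  fixes G :: "('g, 'l) monoid_scheme"
  assumes G: "group G" and \<gamma>: "\<gamma> ` {..n} = carrier G"
    and mult: "\<And>i j k. \<lbrakk>i \<le> n; j \<le> n; k \<le> n; 0 < sc i j k\<rbrakk> \<Longrightarrow> \<gamma> k = \<gamma> i \<otimes>\<^bsub>G\<^esub> \<gamma> j"
  shows "faithful_fusion_grading R n b G (\<lambda>g. b ` {i \<in> {..n}. \<gamma> i = g})"
  unfolding faithful_fusion_grading_def fusion_grading_def
proof (intro conjI ballI G)
  show "finite (carrier G)" unfolding \<gamma>[symmetric] by simp
  show "(\<Union>g\<in>carrier G. b ` {i \<in> {..n}. \<gamma> i = g}) = b ` {..n}" using \<gamma> by auto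
  show "disjoint_family_on (\<lambda>g. b ` {i \<in> {..n}. \<gamma> i = g}) (carrier G)"
    using inj_b by (auto simp: disjoint_family_on_def dest: inj_onD)
next
  fix g h x y
  assume x: "x \<in> b ` {i \<in> {..n}. \<gamma> i = g}" and y: "y \<in> b ` {i \<in> {..n}. \<gamma> i = h}"
  obtain i where i: "i \<le> n" "\<gamma> i = g" "x = b i" using x by auto
  obtain j where j: "j \<le> n" "\<gamma> j = h" "y = b j" using y by auto
  let ?I = "{k \<in> {..n}. \<gamma> k = g \<otimes>\<^bsub>G\<^esub> h}"
  \<comment> \<open>Coefficients in \<open>fusion_grading\<close> are indexed by ring elements, so
    the index is recovered through injectivity of \<open>b\<close>.\<close>
  define a where "a z = nat (sc i j (inv_into {..n} b z))" for z
  have a: "a (b k) = nat (sc i j k)" if "k \<le> n" for k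
    using inv_into_f_f[OF inj_b] that by (simp add: a_def)
  have "x \<otimes> y = (\<Oplus>k\<in>{..n}. add_pow R (sc i j k) (b k))"
    using coord_expansion[of "b i \<otimes> b j"] i j by (simp add: str_const_def)
  \<comment> \<open>Indices of another degree are not constituents, and nonnegativity makes their
    coefficients zero.\<close>
  also have "\<dots> = (\<Oplus>k\<in>?I. add_pow R (sc i j k) (b k))"
  proof (rule add.finprod_mono_neutral_cong_right)
    show "\<And>k. k \<in> {..n} - ?I \<Longrightarrow> add_pow R (sc i j k) (b k) = \<zero>"
    proof -
      fix k assume k: "k \<in> {..n} - ?I"
      then have "\<not> 0 < sc i j k" using mult[of i j k] i j by auto
      then have "sc i j k = 0" using str_const_nonneg[of i j k] i j k by auto
      then show "add_pow R (sc i j k) (b k) = \<zero>" by (simp add: add_pow_def)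
    qed
  qed auto
  also have "\<dots> = (\<Oplus>k\<in>?I. add_pow R (a (b k)) (b k))"
    using i j str_const_nonneg by (intro finsum_cong') (auto simp: a add_pow_int_ge)
  also have "\<dots> = (\<Oplus>z\<in>b ` ?I. add_pow R (a z) z)"
    by (rule finsum_reindex[symmetric]) (auto intro: inj_on_subset[OF inj_b])
  finally show "\<exists>a :: 'a \<Rightarrow> nat. x \<otimes> y = (\<Oplus>z\<in>b ` ?I. add_pow R (a z) z)" by blast
next
  fix g assume "g \<in> carrier G"
  then have "g \<in> \<gamma> ` {..n}" using \<gamma> by simp
  then show "b ` {i \<in> {..n}. \<gamma> i = g} \<noteq> {}" by auto
qed

end

theorem proposition2p8:
  fixes R :: "('a, 'm) ring_scheme" (structure)
    and n :: nat and b :: "nat \<Rightarrow> 'a"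
  assumes "fusion_ring R n b"
  shows "\<exists>B. faithful_fusion_grading R n b (Gal (K1 R n b) (K0 R n b)) B"
proof -
  interpret fusion_ring R n b by (rule assms)
  let ?G = "Gal (K1 R n b) (K0 R n b)"
  obtain E :: "(complex \<Rightarrow> complex) \<Rightarrow> nat set" where G: "group ?G"
    and E: "\<And>\<sigma>. \<sigma> \<in> carrier ?G \<Longrightarrow> E \<sigma> \<subseteq> {..n}" "inj_on E (carrier ?G)"
      "\<And>\<sigma> \<tau>. \<lbrakk>\<sigma> \<in> carrier ?G; \<tau> \<in> carrier ?G\<rbrakk> \<Longrightarrow> E (\<sigma> \<otimes>\<^bsub>?G\<^esub> \<tau>) = sym_diff (E \<sigma>) (E \<tau>)"
      "\<And>\<sigma> i j k. \<lbrakk>\<sigma> \<in> carrier ?G; i \<le> n; j \<le> n; k \<le> n; 0 < sc i j k\<rbrakk> \<Longrightarrow>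
        k \<in> E \<sigma> \<longleftrightarrow> (i \<in> E \<sigma>) \<noteq> (j \<in> E \<sigma>)"
    using Gal_sign_patterns by blast
  obtain \<gamma> where \<gamma>: "\<gamma> ` {..n} = carrier ?G"
    and mult: "\<And>i j k. \<lbrakk>i \<in> {..n}; j \<in> {..n}; k \<in> {..n}; 0 < sc i j k\<rbrakk> \<Longrightarrow>
      \<gamma> k = \<gamma> i \<otimes>\<^bsub>?G\<^esub> \<gamma> j"
  \<comment> \<open>The relation \<open>M\<close> is positivity of the structure constant;
    constituents exist by \<open>sc_nonzero\<close>.\<close>
  proof (rule group.onto_grading_of_sign_patterns[OF G, of "{..n}" E "\<lambda>i j k. 0 < sc i j k"])
    show "\<exists>k\<in>{..n}. 0 < sc i j k" if "i \<in> {..n}" "j \<in> {..n}" for i j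
      using that sc_nonzero[of i j] by auto
  qed (use E in auto)
  show ?thesis
    by (rule exI, rule faithful_grading_of_index_grading[OF G \<gamma>]) (simp add: mult)
qed

end
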